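(* Let $k\ge 0$ be an integer and let $p$ be an odd prime. For $c\in\mathbb{C}$ let $f_c(z)=z^p+c$. The values of $c\in\mathbb{C}$ for which $0$ is strictly $(k,1)$-preperiodic under $f_c$, if there are any, are algebraic numbers forming exactly one orbit under the action of the absolute Galois group $\mathrm{Gal}(\overline{\mathbb{Q}}/\mathbb{Q})$, where $\overline{\mathbb{Q}}\subset\mathbb{C}$ is the algebraic closure of $\mathbb{Q}$.
   Context: For a polynomial $g\in\mathbb{C}[z]$, $g^0=\mathrm{id}$ and $g^m=g\circ g^{m-1}$. For integers $k\ge 0$, $n\ge 1$, a point $x\in\mathbb{C}$ is strictly $(k,n)$-preperiodic under $g$ if $g^{k+n}(x)=g^k(x)$ and $g^{l+m}(x)\ne g^l(x)$ for all integers $0\le l\le k$, $1\le m\le n$ with $(l,m)\neq(k,n)$. *)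

theory Defs
  imports
    "HOL-Computational_Algebra.Computational_Algebra"
    "HOL-Algebra.Group_Action"
begin

definition strictly_preperiodic :: "complex poly \<Rightarrow> nat \<Rightarrow> nat \<Rightarrow> complex \<Rightarrow> bool" where
  "strictly_preperiodic g k n x \<longleftrightarrow>
     n \<ge> 1 \<and>
     (poly g ^^ (k + n)) x = (poly g ^^ k) x \<and>
     (\<forall>l m. l \<le> k \<longrightarrow> 1 \<le> m \<longrightarrow> m \<le> n \<longrightarrow> (l, m) \<noteq> (k, n) \<longrightarrow>
        (poly g ^^ (l + m)) x \<noteq> (poly g ^^ l) x)"

definition unicritical_poly :: "nat \<Rightarrow> complex \<Rightarrow> complex poly" where
  "unicritical_poly d c = monom 1 d + [:c:]"

definition Qbar :: "complex set" where
  "Qbar = {x. algebraic x}"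

(* Elements of BijGroup Qbar are bijections of Qbar onto itself that are
   undefined off Qbar, so each automorphism is represented exactly once. *)
definition absolute_Galois_group :: "(complex \<Rightarrow> complex) monoid" where
  "absolute_Galois_group = (BijGroup Qbar)
     \<lparr>carrier := {\<sigma> \<in> carrier (BijGroup Qbar).
        (\<forall>x\<in>Qbar. \<forall>y\<in>Qbar. \<sigma> (x + y) = \<sigma> x + \<sigma> y) \<and>
        (\<forall>x\<in>Qbar. \<forall>y\<in>Qbar. \<sigma> (x * y) = \<sigma> x * \<sigma> y) \<and>
        (\<forall>q\<in>\<rat>. \<sigma> q = q)}\<rparr>"

end

theory Submission
  imports Defs
begin

text \<open>
  The critical orbit of \<open>f(z) = z ^ p + c\<close> is \<open>0, c, c ^ p + c, ...\<close>, and its \<open>n\<close>-th term is \<open>c * b\<^sub>n(c)\<close> for an integer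
  polynomial \<open>b\<^sub>n\<close>. If \<open>0\<close> is strictly \<open>(k, 1)\<close>-preperiodic, the terms with indices \<open>k\<close> and \<open>k - 1\<close> are
  distinct but have equal \<open>p\<close>-th powers, since adding \<open>c\<close> to these powers gives the same fixed point. Hence \<open>c\<close> is
  a root of \<open>(b\<^sub>k ^ p - b\<^bsub>k-1\<^esub> ^ p) / (b\<^sub>k - b\<^bsub>k-1\<^esub>)\<close>, as stated in \<open>preperiod_poly_root\<close>. The exceptional
  cases are \<open>k = 0\<close>, where \<open>c = 0\<close>, and \<open>k = 1\<close>, where no such \<open>c\<close> exists.

  This quotient is irreducible by Eisenstein's criterion at \<open>p\<close> (\<open>irreducible_preperiod_poly\<close>). Modulo \<open>p\<close> the
  Frobenius identity \<open>x ^ p - y ^ p = (x - y) ^ p\<close> shows that \<open>b\<^bsub>n+1\<^esub> - b\<^sub>n\<close> is a power of the variable, and therefore so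
  is the quotient, which is congruent to \<open>(b\<^sub>k - b\<^bsub>k-1\<^esub>) ^ (p - 1)\<close>. Its constant coefficient is \<open>p\<close>, because \<open>b\<^sub>k\<close>
  and \<open>b\<^bsub>k-1\<^esub>\<close> both take the value \<open>1\<close> at \<open>0\<close> when \<open>k \<ge> 2\<close>.

  So any two such parameters are roots of the same irreducible polynomial and satisfy the same integer polynomial
  relations. By \<open>exists_automorphism_mapsto\<close> an automorphism of the field of algebraic numbers carries one to the
  other; it is a maximal extension, given by Zorn's lemma, of the embedding sending one parameter to the other. Conversely,
  automorphisms preserve all equalities and inequalities in the critical orbit, so the set of parameters is stable.
\<close>

section \<open>Algebraic numbers form a ring\<close>

interpretation Q: vector_space "\<lambda>(q::rat) (z::complex). of_rat q * z"
  by unfold_locales (simp_all add: algebra_simps of_rat_add of_rat_mult)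

text \<open>
  Multiplication is bilinear over the rationals, so products of elements of two spans lie in the
  span of the products of the generators.
\<close>

lemma mult_mem_span:
  assumes "u \<in> Q.span A" "v \<in> Q.span B"
  shows "u * v \<in> Q.span ((\<lambda>(a, b). a * b) ` (A \<times> B))"
proof -
  let ?V = "Q.span ((\<lambda>(a, b). a * b) ` (A \<times> B))"
  have *: "a * v \<in> ?V" if "a \<in> A" for a
    using assms(2)
  proof (induction rule: Q.span_induct_alt)
    case base
    show ?case by (simp add: Q.span_zero)
  next
    case (step c b w)
    have "a * b \<in> ?V" using that step by (intro Q.span_base) auto
    hence "of_rat c * (a * b) + a * w \<in> ?V"
      using step by (intro Q.span_add Q.span_scale)
    thus ?case by (simp add: algebra_simps)
  qed
  show ?thesis using assms(1)
  proof (induction rule: Q.span_induct_alt)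
    case base
    show ?case by (simp add: Q.span_zero)
  next
    case (step c a w)
    have "of_rat c * (a * v) + w * v \<in> ?V"
      using step * by (intro Q.span_add Q.span_scale) auto
    thus ?case by (simp add: algebra_simps)
  qed
qed

text \<open>
  This is the usual criterion that \<open>z\<close> is algebraic iff \<open>\<rat>[z]\<close> is finite-dimensional, phrased without
  dimensions. A polynomial relation of degree \<open>n\<close> rewrites every power of \<open>z\<close> in terms of the first
  \<open>n\<close>; conversely, more powers than spanning vectors must be linearly dependent. Unlike
  the existence of an annihilating polynomial, this form passes to sums and products directly.
\<close>

lemma algebraic_iff_powers_in_finite_span:
  "algebraic z \<longleftrightarrow> (\<exists>B. finite B \<and> (\<forall>k. z ^ k \<in> Q.span B))"
proof
  assume "algebraic z"
  then obtain p where p: "p \<noteq> 0" "poly (map_poly of_int p) z = 0"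
    by (rule algebraicE')
  define n where "n = degree p"
  define B where "B = (\<lambda>i. z ^ i) ` {..<n}"
  have lc: "lead_coeff p \<noteq> 0" using p by simp
  have red: "z ^ k \<in> Q.span B" for k
  proof (induction k rule: less_induct)
    case (less k)
    show ?case
    proof (cases "k < n")
      case True
      thus ?thesis unfolding B_def by (intro Q.span_base) auto
    next
      case False
      have "0 = z ^ (k - n) * poly (map_poly of_int p) z" using p by simp
      also have "poly (map_poly of_int p) z = (\<Sum>i\<le>n. of_int (coeff p i) * z ^ i)"
        by (simp add: poly_altdef n_def coeff_map_poly degree_map_poly)
      also have "\<dots> = (\<Sum>i<n. of_int (coeff p i) * z ^ i) + of_int (lead_coeff p) * z ^ n"
        by (simp add: n_def flip: lessThan_Suc_atMost)
      also have "z ^ (k - n) * \<dots> =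
          (\<Sum>i<n. of_int (coeff p i) * z ^ (k - n + i)) + of_int (lead_coeff p) * z ^ k"
        using False by (simp add: distrib_left sum_distrib_left mult.left_commute flip: power_add)
      finally have "z ^ k = - (\<Sum>i<n. of_int (coeff p i) * z ^ (k - n + i)) / of_int (lead_coeff p)"
        using lc by (simp add: field_simps add_eq_0_iff)
      also have "\<dots> = (\<Sum>i<n. of_rat (- of_int (coeff p i) / of_int (lead_coeff p)) * z ^ (k - n + i))"
        by (simp add: sum_divide_distrib sum_negf of_rat_divide of_rat_minus)
      also have "\<dots> \<in> Q.span B"
        using False less by (intro Q.span_sum Q.span_scale) auto
      finally show ?thesis .
    qed
  qed
  show "\<exists>B. finite B \<and> (\<forall>k. z ^ k \<in> Q.span B)"
    using red by (intro exI[of _ B]) (simp add: B_def)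
next
  assume "\<exists>B. finite B \<and> (\<forall>k. z ^ k \<in> Q.span B)"
  then obtain B where B: "finite B" "\<And>k. z ^ k \<in> Q.span B" by blast
  define N where "N = card B"
  show "algebraic z"
    \<comment> \<open>Linear dependence is a property of sets, so coinciding powers are treated separately;
       they satisfy a relation of the form \<open>z ^ i - z ^ j = 0\<close>.\<close>
  proof (cases "inj_on (\<lambda>i. z ^ i) {..N}")
    case False
    then obtain i j where ij: "i \<noteq> j" "z ^ i = z ^ j" by (auto simp: inj_on_def)
    have "coeff (monom (1::complex) i - monom 1 j) i \<noteq> 0" using ij by simp
    hence "monom (1::complex) i - monom 1 j \<noteq> 0" by (metis coeff_0)
    thus ?thesis
      using ij by (intro algebraicI'[of "monom 1 i - monom 1 j"]) (auto simp: poly_monom)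
  next
    case True
    define P where "P = (\<lambda>i. z ^ i) ` {..N}"
    have "card P = Suc N" using True by (simp add: P_def card_image)
    moreover have "P \<subseteq> Q.span B" using B by (auto simp: P_def)
    ultimately have "Q.dependent P"
      using Q.independent_span_bound[OF B(1)] by (fastforce simp: N_def)
    then obtain u where u: "\<exists>v\<in>P. u v \<noteq> 0" "(\<Sum>v\<in>P. of_rat (u v) * v) = 0"
      using Q.dependent_finite[of P] by (auto simp: P_def)
    define g where "g = (\<Sum>i\<le>N. monom (of_rat (u (z ^ i)) :: complex) i)"
    have cg: "coeff g i = (if i \<le> N then of_rat (u (z ^ i)) else 0)" for i
      by (simp add: g_def coeff_sum sum.delta)
    have "poly g z = (\<Sum>i\<le>N. of_rat (u (z ^ i)) * z ^ i)"
      by (simp add: g_def poly_sum poly_monom)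
    also have "\<dots> = (\<Sum>v\<in>P. of_rat (u v) * v)"
      unfolding P_def using True by (simp add: sum.reindex)
    finally have "poly g z = 0" using u by simp
    moreover obtain i where "i \<le> N" "u (z ^ i) \<noteq> 0" using u by (auto simp: P_def)
    hence "coeff g i \<noteq> 0" by (simp add: cg)
    hence "g \<noteq> 0" by auto
    ultimately show ?thesis by (intro algebraicI'[of g]) (auto simp: cg)
  qed
qed

text \<open>
  If \<open>A\<close> spans all powers of \<open>x\<close> and \<open>B\<close> all powers of \<open>y\<close>, the pairwise products span all
  \<open>x ^ i * y ^ j\<close>, hence all powers of \<open>x + y\<close> (binomial theorem) and of \<open>x * y\<close>.
\<close>

lemma
  fixes x y :: complex
  assumes "algebraic x" "algebraic y"
  shows algebraic_add: "algebraic (x + y)" and algebraic_mult: "algebraic (x * y)"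
proof -
  obtain A B where A: "finite A" "\<And>k. x ^ k \<in> Q.span A" and B: "finite B" "\<And>k. y ^ k \<in> Q.span B"
    using assms by (auto simp: algebraic_iff_powers_in_finite_span)
  define C where "C = (\<lambda>(a, b). a * b) ` (A \<times> B)"
  have C: "finite C" "x ^ i * y ^ j \<in> Q.span C" for i j
    using A B mult_mem_span by (auto simp: C_def)
  have "(x + y) ^ k \<in> Q.span C" for k
  proof -
    have "(x + y) ^ k = (\<Sum>i\<le>k. of_rat (of_nat (k choose i)) * (x ^ i * y ^ (k - i)))"
      by (simp add: binomial_ring mult.assoc)
    also have "\<dots> \<in> Q.span C" using C by (intro Q.span_sum Q.span_scale)
    finally show ?thesis .
  qed
  thus "algebraic (x + y)" using C by (auto simp: algebraic_iff_powers_in_finite_span)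
  show "algebraic (x * y)"
    using C by (auto simp: algebraic_iff_powers_in_finite_span power_mult_distrib)
qed

lemma algebraic_poly:
  fixes x :: complex
  assumes "\<And>i. algebraic (coeff g i)" "algebraic x"
  shows "algebraic (poly g x)"
  using assms(1)
proof (induction g)
  case 0
  show ?case by simp
next
  case (pCons a g)
  have "algebraic a" using pCons.prems[of 0] by simp
  moreover have "algebraic (coeff g i)" for i using pCons.prems[of "Suc i"] by simp
  ultimately show ?case
    using pCons.IH assms(2) by (simp add: algebraic_add algebraic_mult)
qed

section \<open>Irreducible integer polynomials and their roots\<close>

abbreviation ieval :: "int poly \<Rightarrow> 'a::field_char_0 \<Rightarrow> 'a" where
  "ieval p x \<equiv> poly (map_poly of_int p) x"

lemma ieval_pCons [simp]: "ieval (pCons a p) x = of_int a + x * ieval p x"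
  by (simp add: map_poly_pCons)

lemma ieval_add [simp]: "ieval (p + q) x = ieval p x + ieval q x"
proof -
  have "map_poly of_int (p + q) = (map_poly of_int p + map_poly of_int q :: 'a poly)"
    by (rule poly_eqI) (simp add: coeff_map_poly)
  thus ?thesis by simp
qed

lemma ieval_smult [simp]: "ieval (smult a p) x = of_int a * ieval p x"
  by (induction p) (simp_all add: algebra_simps)

lemma ieval_mult [simp]: "ieval (p * q) x = ieval p x * ieval q x"
  by (induction p) (simp_all add: algebra_simps)

lemma ieval_power [simp]: "ieval (p ^ n) x = ieval p x ^ n"
  by (induction n) simp_all

lemma ieval_sum [simp]: "ieval (\<Sum>i\<in>I. p i) x = (\<Sum>i\<in>I. ieval (p i) x)"
  by (induction I rule: infinite_finite_induct) simp_all

lemma ieval_monom [simp]: "ieval (monom a n) x = of_int a * x ^ n"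
  by (simp add: map_poly_monom poly_monom)

text \<open>
  Suppose \<open>f = g * h\<close>. As \<open>q\<^sup>2\<close> does not divide the constant coefficient, exactly one factor, say
  \<open>g\<close>, has constant coefficient divisible by \<open>q\<close>. At the least index \<open>i\<close> where \<open>q\<close> does not divide
  the coefficient of \<open>g\<close>, it does not divide that of \<open>f\<close> either, so \<open>i\<close> is at least the
  degree of \<open>f\<close>. Then \<open>h\<close> is a constant, and primitivity of \<open>f\<close> makes it a unit.
\<close>

lemma eisenstein_criterion:
  fixes f :: "int poly" and q :: int
  assumes q: "prime q" and deg: "degree f > 0" and cont: "content f = 1"
    and lead: "\<not> q dvd lead_coeff f"
    and low: "\<And>i. i < degree f \<Longrightarrow> q dvd coeff f i"
    and const: "\<not> q ^ 2 dvd coeff f 0"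
  shows "irreducible f"
proof -
  have pe: "prime_elem q" using q by (rule prime_imp_prime_elem)
  have key: "h dvd 1" if f: "f = g * h" and g0: "q dvd coeff g 0" for g h
  proof -
    have h0: "\<not> q dvd coeff h 0"
    proof
      assume "q dvd coeff h 0"
      with g0 have "q * q dvd coeff g 0 * coeff h 0" by (rule mult_dvd_mono)
      with const f show False by (simp add: power2_eq_square coeff_mult)
    qed
    have nz: "g \<noteq> 0" "h \<noteq> 0" using deg f by auto
    have ex: "\<not> q dvd lead_coeff g"
      using lead f by (auto simp: lead_coeff_mult)
    define i where "i = (LEAST i. \<not> q dvd coeff g i)"
    have i: "\<not> q dvd coeff g i" unfolding i_def using ex by (rule LeastI)
    have below: "q dvd coeff g j" if "j < i" for j
      using not_less_Least that unfolding i_def by blast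
    have "i \<le> degree g" unfolding i_def using ex by (rule Least_le)
    have "coeff f i = (\<Sum>j<i. coeff g j * coeff h (i - j)) + coeff g i * coeff h 0"
      by (simp add: f coeff_mult flip: lessThan_Suc_atMost)
    moreover have "q dvd (\<Sum>j<i. coeff g j * coeff h (i - j))"
      using below by (intro dvd_sum) auto
    moreover have "\<not> q dvd coeff g i * coeff h 0"
      using i h0 pe by (simp add: prime_elem_dvd_mult_iff)
    ultimately have "\<not> q dvd coeff f i" by (simp add: dvd_add_right_iff)
    hence "degree f \<le> i" using low by (meson not_le)
    hence "degree f \<le> degree g" using \<open>i \<le> degree g\<close> by simp
    hence "degree h = 0" using f nz by (simp add: degree_mult_eq)
    then obtain a where a: "h = [:a:]" by (rule degree_eq_zeroE)
    have "[:a:] dvd f" unfolding f a by (rule dvd_triv_right)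
    hence "a dvd 1" using cont by (simp add: const_poly_dvd_iff_dvd_content)
    thus ?thesis using a by (simp add: is_unit_const_poly_iff)
  qed
  show ?thesis
  proof (rule irreducibleI)
    show "f \<noteq> 0" using deg by auto
    show "\<not> f dvd 1" using deg by (auto simp: is_unit_poly_iff)
    fix g h assume f: "f = g * h"
    have "q dvd coeff g 0 * coeff h 0"
      using low[OF deg] f by (simp add: coeff_mult)
    hence "q dvd coeff g 0 \<or> q dvd coeff h 0" using pe by (simp add: prime_elem_dvd_mult_iff)
    thus "g dvd 1 \<or> h dvd 1" using key[of g h] key[of h g] f by (auto simp: mult.commute)
  qed
qed

text \<open>
  Over a field this would be immediate from the division algorithm. Over the integers, take a
  nonzero \<open>g\<close> of least degree vanishing at \<open>\<alpha>\<close>; pseudo-division shows that \<open>g\<close> divides a nonzero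
  integer multiple of every polynomial vanishing at \<open>\<alpha>\<close>. Since \<open>f\<close> is prime, applying this to \<open>f\<close> gives
  \<open>f dvd g\<close>, and applying it to \<open>h\<close> gives \<open>f dvd [:a:] * h\<close>, where \<open>f\<close> cannot divide the constant.
\<close>

lemma irreducible_dvd_of_root:
  fixes f h :: "int poly" and \<alpha> :: "'a::field_char_0"
  assumes irr: "irreducible f" and deg: "degree f > 0"
    and f: "ieval f \<alpha> = 0" and h: "ieval h \<alpha> = 0"
  shows "f dvd h"
proof -
  have pe: "prime_elem f" using irr by (rule irreducible_imp_prime_poly)
  define N where "N = (LEAST d. \<exists>g::int poly. g \<noteq> 0 \<and> ieval g \<alpha> = 0 \<and> degree g = d)"
  have "\<exists>g::int poly. g \<noteq> 0 \<and> ieval g \<alpha> = 0 \<and> degree g = N"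
    unfolding N_def by (rule LeastI[of _ "degree f"], rule exI[of _ f]) (use f deg in auto)
  then obtain g :: "int poly" where g: "g \<noteq> 0" "ieval g \<alpha> = 0" "degree g = N" by blast
  have min: "degree g \<le> degree r" if "r \<noteq> 0" "ieval r \<alpha> = 0" for r
    unfolding g(3) N_def by (rule Least_le) (use that in blast)
  have div: "\<exists>a q. a \<noteq> 0 \<and> [:a:] * u = g * q" if u: "ieval u \<alpha> = 0" for u
  proof -
    obtain a q where a: "a \<noteq> 0" "smult a u = g * q + pseudo_mod u g"
      using pseudo_mod(1)[OF g(1)] by blast
    have "ieval (smult a u) \<alpha> = ieval (g * q + pseudo_mod u g) \<alpha>" using a by simp
    hence "ieval (pseudo_mod u g) \<alpha> = 0" using u g by simp
    hence "pseudo_mod u g = 0" using min pseudo_mod(2)[OF g(1), of u] by force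
    thus ?thesis using a by auto
  qed
  have nd: "\<not> f dvd [:a:]" if "a \<noteq> 0" for a
  proof
    assume "f dvd [:a:]"
    hence "degree f \<le> degree [:a:]" by (rule dvd_imp_degree_le) (use that in simp)
    thus False using deg by simp
  qed
  have "f dvd g"
  proof -
    obtain a q where a: "a \<noteq> 0" "[:a:] * f = g * q" using div[OF f] by blast
    have "f dvd g * q" using a(2) by (metis dvd_triv_right)
    moreover have "\<not> f dvd q"
    proof
      assume "f dvd q"
      then obtain s where "q = f * s" by auto
      hence "f * [:a:] = f * (g * s)" using a(2) by (simp add: ac_simps)
      hence "[:a:] = g * s" using deg by (metis degree_0 less_irrefl mult_cancel_left)
      hence "g dvd [:a:]" by simp
      hence "degree g \<le> 0" using dvd_imp_degree_le[of g "[:a:]"] a(1) by simp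
      then obtain b where "g = [:b:]" using degree_eq_zeroE by blast
      thus False using g by simp
    qed
    ultimately show ?thesis using pe by (simp add: prime_elem_dvd_mult_iff)
  qed
  obtain a q where a: "a \<noteq> 0" "[:a:] * h = g * q" using div[OF h] by blast
  have "f dvd [:a:] * h" using \<open>f dvd g\<close> unfolding a(2) by simp
  thus ?thesis using pe nd[OF a(1)] by (simp only: prime_elem_dvd_mult_iff) blast
qed

section \<open>Automorphisms of the field of algebraic numbers\<close>

text \<open>
  An embedding of a ring of algebraic numbers into the complex numbers is represented by its graph, a
  subring of \<open>\<complex> \<times> \<complex>\<close>. The union of a chain of graphs is again a graph, so Zorn's lemma applies to plain
  inclusion. Only rings are required: for algebraic numbers closure under inverses and
  injectivity are automatic.
\<close>

locale partial_embedding =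
  fixes R :: "(complex \<times> complex) set"
  assumes one: "(1, 1) \<in> R"
    and diff: "(x, y) \<in> R \<Longrightarrow> (x', y') \<in> R \<Longrightarrow> (x - x', y - y') \<in> R"
    and mult: "(x, y) \<in> R \<Longrightarrow> (x', y') \<in> R \<Longrightarrow> (x * x', y * y') \<in> R"
    and zero_imp_zero: "(0, y) \<in> R \<Longrightarrow> y = 0"
    and algebraic_fst: "(x, y) \<in> R \<Longrightarrow> algebraic x"
begin

lemma zero: "(0, 0) \<in> R"
  using diff[OF one one] by simp

lemma add: "(x, y) \<in> R \<Longrightarrow> (x', y') \<in> R \<Longrightarrow> (x + x', y + y') \<in> R"
  using diff[OF _ diff[OF zero]] by fastforce

lemma of_int: "(of_int n, of_int n) \<in> R"
proof (induction n rule: int_induct[of _ 0])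
  case base
  show ?case using zero by simp
next
  case (step1 i)
  thus ?case using add[OF _ one] by fastforce
next
  case (step2 i)
  thus ?case using diff[OF _ one] by fastforce
qed

lemma ieval_mem: "(x, y) \<in> R \<Longrightarrow> (ieval p x, ieval p y) \<in> R"
  by (induction p) (auto intro: zero add mult of_int)

lemma sum_mem: "(\<And>i. i \<in> I \<Longrightarrow> (u i, v i) \<in> R) \<Longrightarrow> (sum u I, sum v I) \<in> R"
  by (induction I rule: infinite_finite_induct) (auto intro: zero add)

lemma root_transfer: "(x, y) \<in> R \<Longrightarrow> ieval p x = 0 \<Longrightarrow> ieval p y = 0"
  using ieval_mem[of x y p] zero_imp_zero by simp

lemma algebraic_snd:
  assumes "(x, y) \<in> R"
  shows "algebraic y"
proof -
  obtain p where p: "p \<noteq> 0" "ieval p x = 0"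
    using algebraic_fst[OF assms] by (rule algebraicE')
  have "map_poly of_int p \<noteq> (0 :: complex poly)" using p by (simp add: map_poly_eq_0_iff)
  thus ?thesis
    using root_transfer[OF assms p(2)]
    by (intro algebraicI[of "map_poly of_int p"]) (auto simp: coeff_map_poly)
qed

text \<open>
  Injectivity comes for free: a nonzero algebraic \<open>x\<close> is a root of an integer polynomial with nonzero
  constant coefficient. Its image \<open>y\<close> is a root of the same polynomial and is therefore nonzero.
\<close>

lemma zero_iff_zero:
  assumes "(x, y) \<in> R"
  shows "x = 0 \<longleftrightarrow> y = 0"
proof
  assume "x = 0"
  with assms show "y = 0" using zero_imp_zero by simp
next
  assume y: "y = 0"
  show "x = 0"
  proof (rule ccontr)
    assume "x \<noteq> 0"
    then obtain p where p: "coeff p 0 \<noteq> 0" "ieval p x = 0"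
      using algebraicE'_nonzero[OF algebraic_fst[OF assms]] by blast
    from p(2) have "ieval p y = 0" by (rule root_transfer[OF assms])
    with p(1) y show False by (simp add: poly_0_coeff_0 coeff_map_poly)
  qed
qed

lemma functional: "(x, y) \<in> R \<Longrightarrow> (x, y') \<in> R \<Longrightarrow> y = y'"
  using diff[of x y x y'] zero_imp_zero by fastforce

lemma injective: "(x, y) \<in> R \<Longrightarrow> (x', y) \<in> R \<Longrightarrow> x = x'"
  using diff[of x y x' y] zero_iff_zero by fastforce

end

text \<open>
  A pair of polynomials with related coefficients is a polynomial over the ring \<open>R\<close>: the first component has
  coefficients in the domain of the embedding, the second is its image.
\<close>

definition coeffs_related :: "(complex \<times> complex) set \<Rightarrow> complex poly \<Rightarrow> complex poly \<Rightarrow> bool" where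
  "coeffs_related R g h \<longleftrightarrow> (\<forall>i. (coeff g i, coeff h i) \<in> R)"

text \<open>
  This is the ring \<open>R[(x, y)]\<close>, contained in the graph of every extension sending \<open>x\<close> to \<open>y\<close>.
\<close>

definition adjoin :: "(complex \<times> complex) set \<Rightarrow> complex \<Rightarrow> complex \<Rightarrow> (complex \<times> complex) set" where
  "adjoin R x y = {(poly g x, poly h y) | g h. coeffs_related R g h}"

context partial_embedding
begin

lemma coeffs_related_const: "(a, b) \<in> R \<Longrightarrow> coeffs_related R [:a:] [:b:]"
  using zero by (auto simp: coeffs_related_def coeff_pCons split: nat.splits)

lemma coeffs_related_diff:
  "coeffs_related R g h \<Longrightarrow> coeffs_related R g' h' \<Longrightarrow> coeffs_related R (g - g') (h - h')"
  using diff by (auto simp: coeffs_related_def)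

lemma coeffs_related_mult:
  "coeffs_related R g h \<Longrightarrow> coeffs_related R g' h' \<Longrightarrow> coeffs_related R (g * g') (h * h')"
  using mult by (auto simp: coeffs_related_def coeff_mult intro!: sum_mem)

lemma coeffs_related_monom: "(a, b) \<in> R \<Longrightarrow> coeffs_related R (monom a n) (monom b n)"
  using zero by (auto simp: coeffs_related_def)

text \<open>
  The hypothesis on \<open>y\<close> says that the image of every relation satisfied by \<open>x\<close> is satisfied by \<open>y\<close>, which
  is exactly what makes the extension well defined.
\<close>

lemma adjoin_partial_embedding:
  assumes alg: "algebraic x"
    and rel: "\<And>g h. coeffs_related R g h \<Longrightarrow> poly g x = 0 \<Longrightarrow> poly h y = 0"
  shows "partial_embedding (adjoin R x y)"
proof
  show "(1, 1) \<in> adjoin R x y"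
    unfolding adjoin_def using coeffs_related_const[OF one] by force
  show "(a - a', b - b') \<in> adjoin R x y" if "(a, b) \<in> adjoin R x y" "(a', b') \<in> adjoin R x y" for a b a' b'
    using that coeffs_related_diff unfolding adjoin_def mem_Collect_eq prod.inject
    by (metis poly_diff)
  show "(a * a', b * b') \<in> adjoin R x y" if "(a, b) \<in> adjoin R x y" "(a', b') \<in> adjoin R x y" for a b a' b'
    using that coeffs_related_mult unfolding adjoin_def mem_Collect_eq prod.inject
    by (metis poly_mult)
  show "b = 0" if "(0, b) \<in> adjoin R x y" for b
    using that rel by (auto simp: adjoin_def)
  show "algebraic a" if "(a, b) \<in> adjoin R x y" for a b
    using that alg algebraic_fst by (auto simp: adjoin_def coeffs_related_def intro!: algebraic_poly)
qed

lemma subset_adjoin: "R \<subseteq> adjoin R x y"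
  using coeffs_related_const unfolding adjoin_def by force

lemma mem_adjoin: "(x, y) \<in> adjoin R x y"
  using coeffs_related_monom[OF one, of 1] unfolding adjoin_def
  by (force simp: poly_monom)

text \<open>
  Let \<open>g\<close> be a nonzero polynomial of least degree over the domain of the embedding with \<open>g(x) = 0\<close>, and let
  \<open>y\<close> be a root of its image \<open>m\<close>. Any other relation \<open>g'\<close> is reduced to one of lower degree by
  cancelling its leading term against \<open>g\<close>. Since the domain is only a ring, \<open>g'\<close> is first multiplied by the
  leading coefficient of \<open>g\<close>; the corresponding coefficient of \<open>m\<close> is nonzero, so the factor can be removed
  after evaluation at \<open>y\<close>.
\<close>

lemma exists_compatible_image:
  assumes alg: "algebraic x"
  shows "\<exists>y. \<forall>g h. coeffs_related R g h \<longrightarrow> poly g x = 0 \<longrightarrow> poly h y = 0"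
proof -
  define P where "P g m \<longleftrightarrow> coeffs_related R g m \<and> g \<noteq> 0 \<and> poly g x = 0" for g m
  define d where "d = (LEAST d. \<exists>g m. P g m \<and> degree g = d)"
  have "\<exists>d g m. P g m \<and> degree g = d"
  proof -
    obtain p where "p \<noteq> 0" "ieval p x = 0" using alg by (rule algebraicE')
    hence "P (map_poly of_int p) (map_poly of_int p)"
      using of_int by (auto simp: P_def coeffs_related_def coeff_map_poly map_poly_eq_0_iff)
    thus ?thesis by blast
  qed
  hence "\<exists>g m. P g m \<and> degree g = d" unfolding d_def by (rule LeastI_ex)
  then obtain g m where gm: "P g m" "degree g = d" by blast
  have min: "d \<le> degree g'" if "P g' m'" for g' m'
    unfolding d_def by (rule Least_le) (use that in blast)
  have lead: "coeff g d \<noteq> 0" using gm by (auto simp: P_def)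
  have gmrel: "coeffs_related R g m" using gm by (simp add: P_def)
  hence "(coeff g d, coeff m d) \<in> R" by (simp add: coeffs_related_def)
  hence lead_m: "coeff m d \<noteq> 0" using lead zero_iff_zero by blast
  have "d > 0"
  proof (rule ccontr)
    assume "\<not> d > 0"
    then obtain a where "g = [:a:]" using gm(2) degree_eq_zeroE by auto
    thus False using gm(1) by (simp add: P_def)
  qed
  hence "degree m > 0" using le_degree[OF lead_m] by simp
  then obtain y where y: "poly m y = 0"
    using fundamental_theorem_of_algebra[of m] constant_degree[of m] by auto
  have "poly h' y = 0" if "coeffs_related R g' h'" "poly g' x = 0" for g' h'
    using that
  proof (induction "degree g'" arbitrary: g' h' rule: less_induct)
    case less
    note rel = less.prems(1)
    show ?case
    proof (cases "degree g' < d")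
      case True
      hence "g' = 0" using min[of g' h'] less.prems by (force simp: P_def)
      hence "h' = 0" using rel zero_imp_zero by (auto simp: coeffs_related_def intro!: poly_eqI)
      thus ?thesis by simp
    next
      case False
      define n where "n = degree g'"
      have "(coeff g' n, coeff h' n) \<in> R" using rel by (simp add: coeffs_related_def)
      define u where "u = [:coeff g d:] * g' - monom (coeff g' n) (n - d) * g"
      define v where "v = [:coeff m d:] * h' - monom (coeff h' n) (n - d) * m"
      have uv: "coeffs_related R u v"
        unfolding u_def v_def
        using rel gmrel \<open>(coeff g' n, coeff h' n) \<in> R\<close> \<open>(coeff g d, coeff m d) \<in> R\<close>
        by (intro coeffs_related_diff coeffs_related_mult coeffs_related_const coeffs_related_monom)
      have ux: "poly u x = 0" using gm less.prems by (simp add: u_def P_def)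
      have du: "degree u < n"
      proof -
        have "degree u \<le> n"
          unfolding u_def n_def using gm(2) False
          by (intro degree_diff_le order_trans[OF degree_mult_le]
                order_trans[OF add_mono[OF degree_monom_le order_refl]]) auto
        moreover have "coeff u n = 0"
          using False by (simp add: u_def coeff_monom_mult n_def)
        moreover have "n > 0" using \<open>d > 0\<close> False by (simp add: n_def)
        ultimately show ?thesis using coeff_0_degree_minus_1[of u n] by linarith
      qed
      hence "poly v y = 0" using less.hyps uv ux by (simp add: n_def)
      thus ?thesis using lead_m y by (simp add: v_def)
    qed
  qed
  thus ?thesis by blast
qed

end

lemma partial_embedding_Union:
  assumes "\<C> \<noteq> {}" "subset.chain {R. partial_embedding R} \<C>"
  shows "partial_embedding (\<Union>\<C>)"
proof -
  have emb: "partial_embedding R" if "R \<in> \<C>" for R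
    using assms that by (auto simp: subset.chain_def)
  have common: "\<exists>R\<in>\<C>. u \<in> R \<and> v \<in> R" if "u \<in> \<Union>\<C>" "v \<in> \<Union>\<C>" for u v
    using assms that unfolding subset.chain_def by blast
  show ?thesis
  proof
    show "(1, 1) \<in> \<Union>\<C>" using assms(1) emb partial_embedding.one by fastforce
    show "(x - x', y - y') \<in> \<Union>\<C>" if "(x, y) \<in> \<Union>\<C>" "(x', y') \<in> \<Union>\<C>" for x y x' y'
      using common[OF that] emb partial_embedding.diff by blast
    show "(x * x', y * y') \<in> \<Union>\<C>" if "(x, y) \<in> \<Union>\<C>" "(x', y') \<in> \<Union>\<C>" for x y x' y'
      using common[OF that] emb partial_embedding.mult by blast
    show "y = 0" if "(0, y) \<in> \<Union>\<C>" for y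
      using that emb partial_embedding.zero_imp_zero by blast
    show "algebraic x" if "(x, y) \<in> \<Union>\<C>" for x y
      using that emb partial_embedding.algebraic_fst by blast
  qed
qed

text \<open>
  A maximal partial embedding is defined on every algebraic number, since otherwise one could be adjoined.
\<close>

lemma partial_embedding_extends:
  assumes "partial_embedding R\<^sub>0"
  obtains R where "partial_embedding R" "R\<^sub>0 \<subseteq> R" "Domain R = Qbar"
proof -
  define \<A> where "\<A> = {R. partial_embedding R \<and> R\<^sub>0 \<subseteq> R}"
  have "\<exists>M\<in>\<A>. \<forall>X\<in>\<A>. M \<subseteq> X \<longrightarrow> X = M"
  proof (rule subset_Zorn_nonempty)
    show "\<A> \<noteq> {}" using assms by (auto simp: \<A>_def)
    fix \<C> assume C: "\<C> \<noteq> {}" "subset.chain \<A> \<C>"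
    hence "subset.chain {R. partial_embedding R} \<C>"
      by (auto simp: subset.chain_def \<A>_def)
    with C show "\<Union>\<C> \<in> \<A>"
      using partial_embedding_Union by (force simp: \<A>_def subset.chain_def)
  qed
  then obtain R where R: "partial_embedding R" "R\<^sub>0 \<subseteq> R"
    and max: "\<And>X. partial_embedding X \<Longrightarrow> R \<subseteq> X \<Longrightarrow> X = R"
    unfolding \<A>_def by (auto dest: subset_trans)
  interpret partial_embedding R by fact
  have "x \<in> Domain R" if x: "algebraic x" for x
  proof -
    obtain y where "\<forall>g h. coeffs_related R g h \<longrightarrow> poly g x = 0 \<longrightarrow> poly h y = 0"
      using exists_compatible_image[OF x] by blast
    hence "adjoin R x y = R" by (intro max adjoin_partial_embedding subset_adjoin x) auto
    thus ?thesis using mem_adjoin[of x y] by auto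
  qed
  hence "Domain R = Qbar" using algebraic_fst by (auto simp: Qbar_def)
  with R show ?thesis by (intro that)
qed

lemma partial_embedding_Ints: "partial_embedding {(of_int n, of_int n) | n. True}" (is "partial_embedding ?Z")
proof
  show "(1, 1) \<in> ?Z" by (auto intro!: exI[of _ 1])
  show "(x - x', y - y') \<in> ?Z" if "(x, y) \<in> ?Z" "(x', y') \<in> ?Z" for x y x' y'
    using that by (auto simp flip: of_int_diff)
  show "(x * x', y * y') \<in> ?Z" if "(x, y) \<in> ?Z" "(x', y') \<in> ?Z" for x y x' y'
    using that by (auto simp flip: of_int_mult)
qed (auto intro: int_imp_algebraic_int)

lemma mem_absolute_Galois_group_iff:
  "\<sigma> \<in> carrier absolute_Galois_group \<longleftrightarrow>
     \<sigma> \<in> extensional Qbar \<and> bij_betw \<sigma> Qbar Qbar \<and>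
     (\<forall>x\<in>Qbar. \<forall>y\<in>Qbar. \<sigma> (x + y) = \<sigma> x + \<sigma> y) \<and>
     (\<forall>x\<in>Qbar. \<forall>y\<in>Qbar. \<sigma> (x * y) = \<sigma> x * \<sigma> y) \<and> (\<forall>q\<in>\<rat>. \<sigma> q = q)"
  by (auto simp: absolute_Galois_group_def BijGroup_def Bij_def)

text \<open>
  An embedding defined on all algebraic numbers is onto: it maps the finite root set of each integer polynomial
  injectively into itself.
\<close>

lemma exists_automorphism_of_partial_embedding:
  assumes "partial_embedding R" and dom: "Domain R = Qbar"
  obtains \<sigma> where "\<sigma> \<in> carrier absolute_Galois_group" "\<And>x. x \<in> Qbar \<Longrightarrow> (x, \<sigma> x) \<in> R"
proof -
  interpret partial_embedding R by fact
  define \<sigma> where "\<sigma> = (\<lambda>x\<in>Qbar. SOME y. (x, y) \<in> R)"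
  have mem: "(x, \<sigma> x) \<in> R" if "x \<in> Qbar" for x
    using that dom by (auto simp: \<sigma>_def intro: someI)
  have eq: "\<sigma> x = y" if "(x, y) \<in> R" for x y
  proof (rule functional)
    show "(x, \<sigma> x) \<in> R" using that dom by (intro mem) auto
  qed (rule that)
  have add': "\<sigma> (x + y) = \<sigma> x + \<sigma> y" if "x \<in> Qbar" "y \<in> Qbar" for x y
    by (rule eq) (intro add mem that)
  have mult': "\<sigma> (x * y) = \<sigma> x * \<sigma> y" if "x \<in> Qbar" "y \<in> Qbar" for x y
    by (rule eq) (intro mult mem that)
  have into: "\<sigma> x \<in> Qbar" if "x \<in> Qbar" for x
    using algebraic_snd[OF mem[OF that]] by (simp add: Qbar_def)
  have inj: "inj_on \<sigma> Qbar"
  proof (rule inj_onI)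
    fix x y assume xy: "x \<in> Qbar" "y \<in> Qbar" "\<sigma> x = \<sigma> y"
    show "x = y" using mem[OF xy(1)] mem[OF xy(2)] unfolding xy(3) by (rule injective)
  qed
  have surj: "y \<in> \<sigma> ` Qbar" if y: "y \<in> Qbar" for y
  proof -
    have "algebraic y" using y by (simp add: Qbar_def)
    then obtain p where p: "p \<noteq> 0" "ieval p y = 0" by (rule algebraicE')
    define Z where "Z = {z. ieval p z = (0 :: complex)}"
    have nz: "map_poly of_int p \<noteq> (0 :: complex poly)" using p by (simp add: map_poly_eq_0_iff)
    have "finite Z" unfolding Z_def using nz by (rule poly_roots_finite)
    moreover have ZQ: "Z \<subseteq> Qbar"
      using nz by (auto simp: Z_def Qbar_def coeff_map_poly intro!: algebraicI[of "map_poly of_int p"])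
    moreover have "\<sigma> ` Z \<subseteq> Z"
      using root_transfer[OF mem] ZQ by (auto simp: Z_def)
    ultimately have "\<sigma> ` Z = Z"
      using inj by (intro endo_inj_surj) (auto intro: inj_on_subset)
    moreover have "y \<in> Z" using p by (simp add: Z_def)
    ultimately show ?thesis using ZQ by blast
  qed
  have rat: "\<sigma> q = q" if rat_q: "q \<in> \<rat>" for q
  proof -
    obtain a b where b: "b > 0" and q: "q = of_int a / of_int b" using rat_q by (rule Rats_cases')
    have "q \<in> Qbar" using rat_q by (simp add: Qbar_def rat_imp_algebraic)
    hence "(of_int b * q, of_int b * \<sigma> q) \<in> R" by (intro mult of_int mem)
    moreover have "of_int b * q = of_int a" using b q by simp
    ultimately have "(of_int a, of_int b * \<sigma> q) \<in> R" by simp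
    hence "of_int b * \<sigma> q = of_int a" using of_int by (rule functional)
    hence "\<sigma> q = of_int a / of_int b" using b by (simp add: field_simps)
    thus ?thesis using q by simp
  qed
  have "\<sigma> \<in> carrier absolute_Galois_group"
    unfolding mem_absolute_Galois_group_iff bij_betw_def
  proof (intro conjI ballI)
    show "\<sigma> \<in> extensional Qbar" by (simp add: \<sigma>_def)
    show "\<sigma> ` Qbar = Qbar" using into surj by blast
  qed (use inj add' mult' rat in auto)
  thus ?thesis using mem by (rule that)
qed

text \<open>
  If \<open>\<beta>\<close> satisfies all integer relations of \<open>\<alpha>\<close>, then \<open>\<alpha> \<mapsto> \<beta>\<close> extends the identity of the integers to an embedding
  of \<open>\<int>[\<alpha>]\<close>, which extends to all algebraic numbers.
\<close>

lemma exists_automorphism_mapsto: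
  assumes alg: "algebraic \<alpha>"
    and conj: "\<And>h. ieval h \<alpha> = 0 \<Longrightarrow> ieval h \<beta> = 0"
  obtains \<sigma> where "\<sigma> \<in> carrier absolute_Galois_group" "\<sigma> \<alpha> = \<beta>"
proof -
  define Z where "Z = {(of_int n :: complex, of_int n :: complex) | n. True}"
  interpret Z: partial_embedding Z unfolding Z_def by (rule partial_embedding_Ints)
  have "partial_embedding (adjoin Z \<alpha> \<beta>)"
  proof (rule Z.adjoin_partial_embedding[OF alg])
    fix g h assume gh: "coeffs_related Z g h" "poly g \<alpha> = 0"
    hence "g = h" by (auto simp: coeffs_related_def Z_def poly_eq_iff intro!: poly_eqI) metis
    moreover have "coeff g i \<in> \<int>" for i
      using gh(1) by (auto simp: coeffs_related_def Z_def) (metis Ints_of_int)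
    then obtain g' where "g = map_poly of_int g'" by (rule intpolyE)
    ultimately show "poly h \<beta> = 0" using conj[of g'] gh(2) by simp
  qed
  then obtain R where R: "partial_embedding R" "adjoin Z \<alpha> \<beta> \<subseteq> R" "Domain R = Qbar"
    by (rule partial_embedding_extends)
  then obtain \<sigma> where \<sigma>: "\<sigma> \<in> carrier absolute_Galois_group" "\<And>x. x \<in> Qbar \<Longrightarrow> (x, \<sigma> x) \<in> R"
    using exists_automorphism_of_partial_embedding by blast
  have "(\<alpha>, \<sigma> \<alpha>) \<in> R" using \<sigma>(2) alg by (simp add: Qbar_def)
  moreover have "(\<alpha>, \<beta>) \<in> R" using R(2) Z.mem_adjoin by blast
  ultimately have "\<sigma> \<alpha> = \<beta>" using R(1) partial_embedding.functional by blast
  with \<sigma>(1) show ?thesis by (rule that)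
qed

section \<open>The critical orbit of a unicritical polynomial\<close>

text \<open>
  The binomial coefficients strictly between the ends are divisible by the prime \<open>p\<close>. The congruence is
  needed in \<open>\<int>[X]\<close> itself, a ring of characteristic zero.
\<close>

lemma freshmans_dream_dvd:
  fixes x y :: "'a::comm_ring_1"
  assumes "prime p"
  shows "of_nat p dvd (x + y) ^ p - (x ^ p + y ^ p)"
proof -
  have p0: "p > 0" using assms by (rule prime_gt_0_nat)
  define t where "t k = of_nat (p choose k) * x ^ k * y ^ (p - k)" for k
  have "(x + y) ^ p = sum t {..p}" by (simp add: binomial_ring t_def)
  also have "{..p} = insert 0 (insert p {0<..<p})" using p0 by auto
  also have "sum t \<dots> = y ^ p + (x ^ p + sum t {0<..<p})"
    using p0 by (simp add: t_def)
  finally have "(x + y) ^ p - (x ^ p + y ^ p) = sum t {0<..<p}" by simp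
  also have "of_nat p dvd \<dots>"
  proof (rule dvd_sum)
    fix k assume "k \<in> {0<..<p}"
    hence "p dvd p choose k" using assms by (intro dvd_choose_prime) auto
    then obtain m where "p choose k = p * m" ..
    thus "of_nat p dvd t k" by (simp add: t_def mult.assoc)
  qed
  finally show ?thesis .
qed

lemma diff_dvd_power_diff:
  fixes x y :: "'a::comm_ring_1"
  shows "x - y dvd x ^ n - y ^ n"
  by (simp add: power_diff_sumr2)

text \<open>
  The critical orbit of \<open>z ^ p + c\<close> satisfies \<open>a\<^sub>0 = 0\<close> and \<open>a\<^bsub>n+1\<^esub> = a\<^sub>n ^ p + c\<close>. Every \<open>a\<^sub>n\<close> is divisible by \<open>c\<close>
  as a polynomial in \<open>c\<close>; this is the quotient.
\<close>

fun scaled_orbit :: "nat \<Rightarrow> nat \<Rightarrow> int poly" where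
  "scaled_orbit p 0 = 0"
| "scaled_orbit p (Suc n) = monom 1 (p - 1) * scaled_orbit p n ^ p + 1"

text \<open>
  This is the quotient of \<open>b ^ p - a ^ p\<close> by \<open>b - a\<close> for consecutive terms \<open>a\<close>, \<open>b\<close> of the scaled orbit. It vanishes where
  \<open>b / a\<close> is a nontrivial \<open>p\<close>-th root of unity, that is, for \<open>n > 0\<close>, where the critical orbit is constant from
  index \<open>n + 1\<close> on but not from \<open>n\<close> on.
\<close>

definition preperiod_poly :: "nat \<Rightarrow> nat \<Rightarrow> int poly" where
  "preperiod_poly p n = (\<Sum>i<p. scaled_orbit p n ^ (p - Suc i) * scaled_orbit p (Suc n) ^ i)"

text \<open>
  Modulo \<open>p\<close>, taking \<open>p\<close>-th powers is additive, so the difference of consecutive terms obeys \<open>d\<^bsub>n+1\<^esub> = X ^ (p - 1) * d\<^sub>n ^ p\<close>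
  with \<open>d\<^sub>0 = 1\<close>, and it stays a monomial. Oddness of \<open>p\<close> lets the sign through the power.
\<close>

lemma scaled_orbit_step_cong:
  assumes p: "prime p" "odd p"
  shows "[:int p:] dvd scaled_orbit p (Suc n) - scaled_orbit p n - monom 1 (p ^ n - 1)"
proof (induction n)
  case 0
  show ?case using prime_gt_0_nat[OF p(1)] by (simp add: power_0_left)
next
  case (Suc n)
  let ?b = "scaled_orbit p (Suc n)" and ?a = "scaled_orbit p n" and ?M = "monom 1 (p ^ n - 1) :: int poly"
  have p0: "p > 0" using p prime_gt_0_nat by blast
  have 1: "[:int p:] dvd (?b - ?a) ^ p - (?b ^ p - ?a ^ p)"
    using freshmans_dream_dvd[OF p(1), of ?b "- ?a"] p(2) by (simp add: of_nat_poly)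
  have 2: "[:int p:] dvd (?b - ?a) ^ p - ?M ^ p"
    using Suc diff_dvd_power_diff by (rule dvd_trans)
  have "[:int p:] dvd ((?b - ?a) ^ p - ?M ^ p) - ((?b - ?a) ^ p - (?b ^ p - ?a ^ p))"
    using 2 1 by (rule dvd_diff)
  hence "[:int p:] dvd monom 1 (p - 1) * ((?b ^ p - ?a ^ p) - ?M ^ p)"
    by (intro dvd_mult) (simp add: algebra_simps)
  moreover have "p - 1 + (p ^ n - 1) * p = p ^ Suc n - 1"
    using p0 by (simp add: algebra_simps diff_mult_distrib2)
  hence "monom 1 (p - 1) * ?M ^ p = (monom 1 (p ^ Suc n - 1) :: int poly)"
    by (simp add: monom_power mult_monom mult.commute)
  hence "monom 1 (p - 1) * ((?b ^ p - ?a ^ p) - ?M ^ p) =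
      scaled_orbit p (Suc (Suc n)) - ?b - monom 1 (p ^ Suc n - 1)"
    unfolding right_diff_distrib by (simp add: algebra_simps)
  ultimately show ?case by simp
qed

text \<open>
  Modulo \<open>p\<close> the quotient of \<open>b ^ p - a ^ p\<close> by \<open>b - a\<close> is \<open>(b - a) ^ (p - 1)\<close>. This is obtained by cancelling \<open>b - a\<close>, which is
  legitimate because the constant \<open>p\<close> is prime in \<open>\<int>[X]\<close> and does not divide \<open>b - a\<close>.
\<close>

lemma preperiod_poly_cong:
  assumes p: "prime p" "odd p"
  shows "[:int p:] dvd preperiod_poly p n - monom 1 ((p ^ n - 1) * (p - 1))"
proof -
  let ?b = "scaled_orbit p (Suc n)" and ?a = "scaled_orbit p n" and ?M = "monom 1 (p ^ n - 1) :: int poly"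
  have p0: "p > 0" using p prime_gt_0_nat by blast
  have pe: "prime_elem [:int p:]" using p by (simp add: prime_elem_const_poly_iff)
  have cong: "[:int p:] dvd (?b - ?a) - ?M" using scaled_orbit_step_cong[OF p] by simp
  have pM: "\<not> [:int p:] dvd ?M"
    using prime_gt_1_nat[OF p(1)] by (auto simp: const_poly_dvd_iff)
  have nd: "\<not> [:int p:] dvd ?b - ?a"
    using cong pM dvd_diff[of "[:int p:]" "?b - ?a" "?b - ?a - ?M"] by auto
  have fac: "(?b - ?a) * preperiod_poly p n = ?b ^ p - ?a ^ p"
    unfolding preperiod_poly_def by (rule power_diff_sumr2 [symmetric])
  have pw: "(?b - ?a) * (?b - ?a) ^ (p - 1) = (?b - ?a) ^ p"
    using power_minus_mult[OF p0, of "?b - ?a"] by (simp only: mult.commute)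
  have "(?b - ?a) * ((?b - ?a) ^ (p - 1) - preperiod_poly p n) = (?b - ?a) ^ p - (?b ^ p - ?a ^ p)"
    unfolding right_diff_distrib fac pw ..
  moreover have "[:int p:] dvd (?b - ?a) ^ p - (?b ^ p - ?a ^ p)"
    using freshmans_dream_dvd[OF p(1), of ?b "- ?a"] p(2) by (simp add: of_nat_poly)
  ultimately have "[:int p:] dvd (?b - ?a) ^ (p - 1) - preperiod_poly p n"
    using pe nd by (metis prime_elem_dvd_mult_iff)
  moreover have "[:int p:] dvd (?b - ?a) ^ (p - 1) - ?M ^ (p - 1)"
    using cong diff_dvd_power_diff by (rule dvd_trans)
  ultimately have "[:int p:] dvd ((?b - ?a) ^ (p - 1) - ?M ^ (p - 1)) - ((?b - ?a) ^ (p - 1) - preperiod_poly p n)"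
    by (rule dvd_diff[rotated])
  thus ?thesis by (simp add: monom_power)
qed

lemma lead_coeff_add_lower: "degree q < degree r \<Longrightarrow> lead_coeff (r + q) = lead_coeff r"
  by (metis add.commute lead_coeff_add_le)

lemma degree_lead_coeff_scaled_orbit:
  assumes "p > 1"
  shows "degree (scaled_orbit p (Suc n)) = p ^ n - 1 \<and> lead_coeff (scaled_orbit p (Suc n)) = 1"
proof (induction n)
  case 0
  show ?case using assms by (simp add: power_0_left)
next
  case (Suc n)
  let ?b = "scaled_orbit p (Suc n)"
  let ?r = "monom 1 (p - 1) * ?b ^ p"
  have lc: "lead_coeff ?r = 1"
    unfolding lead_coeff_mult lead_coeff_power conjunct2[OF Suc] by (simp add: degree_monom_eq)
  have "?b \<noteq> 0" using conjunct2[OF Suc] by (metis coeff_0 zero_neq_one)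
  hence "degree ?r = p - 1 + p * (p ^ n - 1)"
    by (simp add: degree_mult_eq degree_power_eq degree_monom_eq monom_eq_0_iff conjunct1[OF Suc] del: scaled_orbit.simps)
  also have "\<dots> = p ^ Suc n - 1" using assms by (simp add: algebra_simps diff_mult_distrib2)
  finally have deg: "degree ?r = p ^ Suc n - 1" .
  moreover have "p ^ Suc n > 1" using assms by (intro one_less_power) auto
  ultimately have lt: "degree (1 :: int poly) < degree ?r" by simp
  have "scaled_orbit p (Suc (Suc n)) = ?r + 1" by simp
  show ?case unfolding \<open>scaled_orbit p (Suc (Suc n)) = ?r + 1\<close>
    using lead_coeff_add_lower[OF lt] degree_add_eq_left[OF lt] lc deg by simp
qed

text \<open>
  The term \<open>b ^ (p - 1)\<close> alone has the highest degree, because the degrees of the scaled orbit increase strictly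
  from the term \<open>1\<close> of index \<open>1\<close> on.
\<close>

lemma preperiod_poly_monic:
  assumes p: "p > 1" and n: "n > 0"
  shows "lead_coeff (preperiod_poly p n) = 1"
proof -
  let ?b = "scaled_orbit p (Suc n)" and ?a = "scaled_orbit p n"
  obtain l where l: "n = Suc l" using n gr0_implies_Suc by blast
  have "p ^ l < p ^ n" "p ^ l > 0" using p l by auto
  hence "p ^ l - 1 < p ^ n - 1" by linarith
  moreover have "degree ?a = p ^ l - 1"
    unfolding l by (rule conjunct1[OF degree_lead_coeff_scaled_orbit[OF p]])
  moreover have "degree ?b = p ^ n - 1"
    by (rule conjunct1[OF degree_lead_coeff_scaled_orbit[OF p]])
  ultimately have deg: "degree ?a < degree ?b" by (simp only:)
  have b: "lead_coeff ?b = 1" using degree_lead_coeff_scaled_orbit[OF p, of n] by blast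
  have b0: "?b \<noteq> 0" using deg by auto
  define q where "q = (\<Sum>i<p - 1. ?a ^ (p - Suc i) * ?b ^ i)"
  obtain m where m: "p = Suc m" "m > 0" using p by (cases p) auto
  have eq: "preperiod_poly p n = ?b ^ (p - 1) + q"
    unfolding preperiod_poly_def q_def using m by simp
  have dq: "degree (?b ^ (p - 1)) = (p - 1) * degree ?b" using b0 by (simp add: degree_power_eq)
  have "degree q < (p - 1) * degree ?b"
    unfolding q_def
  proof (rule degree_sum_less)
    show "0 < (p - 1) * degree ?b" using m deg by simp
    fix i assume i: "i \<in> {..<p - 1}"
    have "degree (?a ^ (p - Suc i) * ?b ^ i) \<le> degree ?a * (p - Suc i) + degree ?b * i"
      by (intro order_trans[OF degree_mult_le] add_mono degree_power_le)
    also have "\<dots> < degree ?b * (p - Suc i) + degree ?b * i"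
      using i deg by (simp del: scaled_orbit.simps)
    also have "\<dots> = degree ?b * (p - 1)"
      using i by (simp flip: add_mult_distrib2 del: scaled_orbit.simps)
    finally show "degree (?a ^ (p - Suc i) * ?b ^ i) < (p - 1) * degree ?b" by (simp add: mult.commute)
  qed
  hence "lead_coeff (?b ^ (p - 1) + q) = lead_coeff (?b ^ (p - 1))"
    unfolding dq[symmetric] by (rule lead_coeff_add_lower)
  thus ?thesis using b by (simp add: eq lead_coeff_power del: scaled_orbit.simps)
qed

lemma coeff_0_scaled_orbit:
  assumes "p > 1"
  shows "coeff (scaled_orbit p (Suc n)) 0 = 1"
  using assms by (simp add: coeff_mult)

text \<open>
  Both scaled orbit terms have constant coefficient \<open>1\<close>, and there are \<open>p\<close> summands.
\<close>

lemma coeff_0_preperiod_poly: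
  assumes "p > 1" "n > 0"
  shows "coeff (preperiod_poly p n) 0 = int p"
proof -
  obtain m where m: "n = Suc m" using assms(2) gr0_implies_Suc by blast
  show ?thesis
    by (simp add: preperiod_poly_def coeff_sum m coeff_mult coeff_0_power coeff_0_scaled_orbit[OF assms(1)]
          del: scaled_orbit.simps)
qed

text \<open>
  The polynomial is monic, congruent to a power of \<open>X\<close> modulo \<open>p\<close>, and has constant coefficient \<open>p\<close>: Eisenstein's criterion
  applies. Its degree can be read off from the congruence, as the leading coefficient \<open>1\<close> survives modulo \<open>p\<close>.
\<close>

lemma irreducible_preperiod_poly:
  assumes p: "prime p" "odd p" and n: "n > 0"
  shows "irreducible (preperiod_poly p n)" and "degree (preperiod_poly p n) > 0"
proof -
  let ?Q = "preperiod_poly p n"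
  define N where "N = (p ^ n - 1) * (p - 1)"
  have p1: "p > 1" using p prime_gt_1_nat by blast
  have "p ^ n > 1" using p1 n by (rule one_less_power)
  hence N: "N > 0" using p1 by (simp add: N_def)
  have monic: "lead_coeff ?Q = 1" using p1 n by (rule preperiod_poly_monic)
  have unit: "\<not> int p dvd 1" using p1 by simp
  have c: "int p dvd coeff ?Q i - (if i = N then 1 else 0)" for i
    using preperiod_poly_cong[OF p, of n]
    by (auto simp: const_poly_dvd_iff N_def split: if_splits dest!: spec[of _ i])
  have deg: "degree ?Q = N"
    using c[of "degree ?Q"] monic unit by (auto split: if_splits)
  thus "degree ?Q > 0" using N by simp
  show "irreducible ?Q"
  proof (rule eisenstein_criterion[of "int p"])
    show "prime (int p)" using p by simp
    show "degree ?Q > 0" by fact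
    have "content ?Q dvd 1" using content_dvd_coeff[of ?Q "degree ?Q"] monic by simp
    thus "content ?Q = 1" by (simp only: is_unit_content_iff)
    show "\<not> int p dvd lead_coeff ?Q" using monic unit by simp
    show "int p dvd coeff ?Q i" if "i < degree ?Q" for i
      using c[of i] that deg by simp
    show "\<not> int p ^ 2 dvd coeff ?Q 0"
    proof
      assume "int p ^ 2 dvd coeff ?Q 0"
      hence "int p ^ 2 \<le> int p"
        using p1 by (intro zdvd_imp_le) (auto simp: coeff_0_preperiod_poly[OF p1 n])
      thus False using p1 by (simp add: power2_eq_square)
    qed
  qed
qed

lemma poly_unicritical: "poly (unicritical_poly d c) z = z ^ d + c"
  by (simp add: unicritical_poly_def poly_monom)

lemma critical_orbit_eq:
  assumes "p > 0"
  shows "(poly (unicritical_poly p c) ^^ n) 0 = c * ieval (scaled_orbit p n) c"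
proof (induction n)
  case (Suc n)
  have "c ^ p = c * c ^ (p - 1)" using power_minus_mult[OF assms, of c] by (simp add: mult.commute)
  with Suc show ?case
    by (simp add: poly_unicritical power_mult_distrib algebra_simps)
qed simp

text \<open>
  Write \<open>z n\<close> for the critical orbit. If it is constant from index \<open>n + 1\<close> but not from \<open>n\<close> on, then
  \<open>z (n + 2) = z (n + 1)\<close> says that \<open>z (n + 1)\<close> and \<open>z n\<close> have the same \<open>p\<close>-th power although they differ. Cancelling the powers of \<open>c\<close> leaves
  a root of the quotient polynomial. Preperiod \<open>1\<close> cannot occur: \<open>0\<close> is the only preimage of the critical value.
\<close>

lemma preperiod_poly_root:
  assumes p: "p > 0" and pre: "strictly_preperiodic (unicritical_poly p c) k 1 0"
  shows "k = 0 \<and> c = 0 \<or> (\<exists>n>0. k = Suc n \<and> ieval (preperiod_poly p n) c = 0)"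
proof -
  define z where "z n = (poly (unicritical_poly p c) ^^ n) 0" for n
  have z0: "z 0 = 0" and zS: "z (Suc n) = z n ^ p + c" for n
    by (simp_all add: z_def poly_unicritical)
  have z1: "z (Suc 0) = c" using zS[of 0] z0 p by (simp add: power_0_left)
  have fix_k: "z (Suc k) = z k" using pre by (simp add: strictly_preperiodic_def z_def)
  have strict: "z (Suc l) \<noteq> z l" if "l < k" for l
  proof -
    have "(poly (unicritical_poly p c) ^^ (l + 1)) 0 \<noteq> (poly (unicritical_poly p c) ^^ l) 0"
      using pre that unfolding strictly_preperiodic_def
      by (metis less_imp_le_nat less_irrefl order_refl prod.inject)
    thus ?thesis unfolding z_def Suc_eq_plus1 .
  qed
  show ?thesis
  proof (cases k)
    case 0
    thus ?thesis using fix_k z0 z1 by simp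
  next
    case (Suc n)
    have c: "c \<noteq> 0" using strict[of 0] Suc z0 z1 by simp
    have ne: "z (Suc n) \<noteq> z n" using strict Suc by blast
    have pw: "z (Suc n) ^ p = z n ^ p" using fix_k zS Suc by simp
    have "n > 0"
    proof (rule ccontr)
      assume "\<not> n > 0"
      hence "z (Suc n) ^ p = 0" using pw z0 p by (simp add: power_0_left)
      thus False using ne z0 \<open>\<not> n > 0\<close> by simp
    qed
    let ?a = "ieval (scaled_orbit p n) c" and ?b = "ieval (scaled_orbit p (Suc n)) c"
    have z_eq: "z m = c * ieval (scaled_orbit p m) c" for m
      unfolding z_def by (rule critical_orbit_eq[OF p])
    have "c ^ p * ?b ^ p = c ^ p * ?a ^ p" using pw unfolding z_eq power_mult_distrib .
    hence "?b ^ p = ?a ^ p" using c by (simp del: scaled_orbit.simps)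
    hence "(?b - ?a) * (\<Sum>i<p. ?a ^ (p - Suc i) * ?b ^ i) = 0"
      by (simp only: power_diff_sumr2 [symmetric]) simp
    moreover have "?b \<noteq> ?a" using ne unfolding z_eq by metis
    ultimately have "ieval (preperiod_poly p n) c = 0"
      by (simp add: preperiod_poly_def del: scaled_orbit.simps)
    thus ?thesis using Suc \<open>n > 0\<close> by blast
  qed
qed

section \<open>Galois action on preperiodic parameters\<close>

lemma algebraic_power: "algebraic (x ^ n)" if "algebraic x" for x :: complex
  using that by (induction n) (auto intro: algebraic_mult int_imp_algebraic_int)

lemma Galois_power:
  assumes "\<sigma> \<in> carrier absolute_Galois_group" "x \<in> Qbar"
  shows "\<sigma> (x ^ n) = \<sigma> x ^ n"
proof (induction n)
  case 0
  show ?case using assms(1) by (simp add: mem_absolute_Galois_group_iff)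
next
  case (Suc n)
  have "x ^ n \<in> Qbar" using assms(2) by (simp add: Qbar_def algebraic_power)
  thus ?case using Suc assms by (simp add: mem_absolute_Galois_group_iff)
qed

lemma Galois_critical_orbit:
  assumes \<sigma>: "\<sigma> \<in> carrier absolute_Galois_group" and c: "c \<in> Qbar"
  shows "(poly (unicritical_poly d c) ^^ n) 0 \<in> Qbar \<and>
    \<sigma> ((poly (unicritical_poly d c) ^^ n) 0) = (poly (unicritical_poly d (\<sigma> c)) ^^ n) 0"
proof (induction n)
  case 0
  show ?case using \<sigma> by (simp add: Qbar_def mem_absolute_Galois_group_iff)
next
  case (Suc n)
  define z where "z = (poly (unicritical_poly d c) ^^ n) 0"
  have z: "z \<in> Qbar" using Suc by (simp add: z_def)
  hence zd: "z ^ d \<in> Qbar" by (simp add: Qbar_def algebraic_power)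
  have "z ^ d + c \<in> Qbar" using zd c by (simp add: Qbar_def algebraic_add)
  moreover have "\<sigma> (z ^ d + c) = \<sigma> z ^ d + \<sigma> c"
    using \<sigma> zd c Galois_power[OF \<sigma> z, of d] by (simp add: mem_absolute_Galois_group_iff)
  moreover have "\<sigma> z = (poly (unicritical_poly d (\<sigma> c)) ^^ n) 0" using Suc by (simp add: z_def)
  moreover have "(poly (unicritical_poly d c) ^^ Suc n) 0 = z ^ d + c"
    by (simp only: funpow.simps comp_apply poly_unicritical z_def)
  moreover have "(poly (unicritical_poly d (\<sigma> c)) ^^ Suc n) 0 = \<sigma> z ^ d + \<sigma> c"
    using \<open>\<sigma> z = _\<close> by (simp only: funpow.simps comp_apply poly_unicritical)
  ultimately show ?case by simp
qed

lemma Galois_strictly_preperiodic: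
  assumes \<sigma>: "\<sigma> \<in> carrier absolute_Galois_group" and c: "c \<in> Qbar"
    and pre: "strictly_preperiodic (unicritical_poly d c) k n 0"
  shows "strictly_preperiodic (unicritical_poly d (\<sigma> c)) k n 0"
proof -
  have "inj_on \<sigma> Qbar" using \<sigma> by (simp add: mem_absolute_Galois_group_iff bij_betw_def)
  hence "(poly (unicritical_poly d (\<sigma> c)) ^^ i) 0 = (poly (unicritical_poly d (\<sigma> c)) ^^ j) 0 \<longleftrightarrow>
      (poly (unicritical_poly d c) ^^ i) 0 = (poly (unicritical_poly d c) ^^ j) 0" for i j
    using Galois_critical_orbit[OF \<sigma> c, where d = d and n = i]
      Galois_critical_orbit[OF \<sigma> c, where d = d and n = j]
      inj_on_eq_iff[of \<sigma> Qbar "(poly (unicritical_poly d c) ^^ i) 0" "(poly (unicritical_poly d c) ^^ j) 0"]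
    by presburger
  thus ?thesis using pre unfolding strictly_preperiodic_def by simp
qed

lemma preperiodic_parameter_algebraic:
  assumes p: "prime p" "odd p" and c: "strictly_preperiodic (unicritical_poly p c) k 1 0"
  shows "algebraic c"
proof (cases "c = 0")
  case False
  have "p > 0" using p prime_gt_0_nat by blast
  then obtain n where n: "n > 0" "ieval (preperiod_poly p n) c = 0"
    using preperiod_poly_root[OF _ c] False by blast
  have "preperiod_poly p n \<noteq> 0" using irreducible_preperiod_poly(2)[OF p n(1)] by auto
  hence "map_poly of_int (preperiod_poly p n) \<noteq> (0 :: complex poly)"
    by (simp add: map_poly_eq_0_iff)
  thus ?thesis
    using n(2) by (intro algebraicI[of "map_poly of_int (preperiod_poly p n)"]) (auto simp: coeff_map_poly)
qed auto

text \<open>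
  For \<open>k = 0\<close> both parameters are \<open>0\<close>. Otherwise both are roots of one irreducible polynomial, which divides
  every integer polynomial vanishing at either of them.
\<close>

lemma preperiodic_parameters_same_relations:
  assumes p: "prime p" "odd p"
    and a: "strictly_preperiodic (unicritical_poly p \<alpha>) k 1 0"
    and b: "strictly_preperiodic (unicritical_poly p \<beta>) k 1 0"
    and h: "ieval h \<alpha> = 0"
  shows "ieval h \<beta> = 0"
proof -
  have p0: "p > 0" using p prime_gt_0_nat by blast
  show ?thesis
  proof (cases k)
    case 0
    thus ?thesis using preperiod_poly_root[OF p0 a] preperiod_poly_root[OF p0 b] h by auto
  next
    case (Suc n)
    have n: "n > 0" and roots: "ieval (preperiod_poly p n) \<alpha> = 0" "ieval (preperiod_poly p n) \<beta> = 0"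
      using preperiod_poly_root[OF p0 a] preperiod_poly_root[OF p0 b] Suc by auto
    have "preperiod_poly p n dvd h"
      using irreducible_dvd_of_root[OF irreducible_preperiod_poly[OF p n] roots(1) h] .
    thus ?thesis using roots(2) by auto
  qed
qed

theorem theorem1p4:
  fixes k p :: nat and S :: "complex set"
  assumes "prime p" and "odd p"
  defines "S \<equiv> {c. strictly_preperiodic (unicritical_poly p c) k 1 0}"
  assumes "S \<noteq> {}"
  shows "S \<subseteq> {c. algebraic c} \<and> S \<in> orbits absolute_Galois_group Qbar (\<lambda>\<sigma>. \<sigma>)"
proof
  show alg: "S \<subseteq> {c. algebraic c}"
    using preperiodic_parameter_algebraic[OF assms(1,2)] by (auto simp: S_def)
  obtain \<alpha> where \<alpha>: "\<alpha> \<in> S" using \<open>S \<noteq> {}\<close> by blast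
  have \<alpha>_alg: "\<alpha> \<in> Qbar" using \<alpha> alg by (auto simp: Qbar_def)
  have "S = orbit absolute_Galois_group (\<lambda>\<sigma>. \<sigma>) \<alpha>"
  proof (intro equalityI subsetI)
    fix \<beta> assume \<beta>: "\<beta> \<in> S"
    have rel: "ieval h \<beta> = 0" if "ieval h \<alpha> = 0" for h
      using preperiodic_parameters_same_relations[OF assms(1,2) _ _ that] \<alpha> \<beta> by (simp add: S_def)
    have "algebraic \<alpha>" using \<alpha> alg by blast
    then obtain \<sigma> where "\<sigma> \<in> carrier absolute_Galois_group" "\<sigma> \<alpha> = \<beta>"
      using rel by (rule exists_automorphism_mapsto)
    thus "\<beta> \<in> orbit absolute_Galois_group (\<lambda>\<sigma>. \<sigma>) \<alpha>" by (auto simp: orbit_def)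
  next
    fix \<beta> assume "\<beta> \<in> orbit absolute_Galois_group (\<lambda>\<sigma>. \<sigma>) \<alpha>"
    then obtain \<sigma> where "\<sigma> \<in> carrier absolute_Galois_group" "\<beta> = \<sigma> \<alpha>" by (auto simp: orbit_def)
    thus "\<beta> \<in> S" using Galois_strictly_preperiodic[OF _ \<alpha>_alg] \<alpha> by (simp add: S_def)
  qed
  thus "S \<in> orbits absolute_Galois_group Qbar (\<lambda>\<sigma>. \<sigma>)"
    using \<alpha>_alg by (auto simp: orbits_def)
qed

end
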